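(* Let $(G,c,\mathcal{P})$ be a Steiner Forest instance whose demand graph has exactly one nontrivial connected component, and let $R$ be the vertex set of that component. Then the optimum value of Forest-BCR for $(G,c,\mathcal{P})$ equals the optimum value of Tree-BCR for the Steiner Tree instance $(G,c,R)$ (with any root $r\in R$).
   Context: A Steiner Forest instance $(G,c,\mathcal{P})$ consists of an undirected graph $G=(V,E)$, nonnegative edge costs $c:E\to\mathbb{R}_{\ge0}$, and a collection $\mathcal{P}$ of pairs $\{s,t\}\subseteq V$. The demand graph is the graph on $V$ with an edge $\{s,t\}$ iff $\{s,t\}\in\mathcal{P}$; a connected component is nontrivial if it has more than one vertex. Let $\overrightarrow{E}$ be obtained by replacing each $\{u,v\}\in E$ by $(u,v),(v,u)$, both of cost $c(\{u,v\})$; $\delta^+(U)$ is the set of directed edges leaving $U$. Forest-BCR: variables $x^r_e$ ($r\in V$, $e\in\overrightarrow{E}$), $z^r_P$ ($r\in V$, $P\in\mathcal{P}$); minimize $\sum_{r\in V}\sum_{e}c(e)x^r_e$ subject to $\sum_{r\in V}z^r_P=1$ for all $P$; $\sum_{e\in\delta^+(U)}x^r_e\ge z^r_P$ for all $r\in V$, $P\in\mathcal{P}$, $U\subseteq V\setminus\{r\}$ with $P\cap U\ne\emptyset$; $x,z\ge0$. For a Steiner Tree instance $(G,c,R)$ with terminal set $R\subseteq V$ and a root $r\in R$, Tree-BCR is: minimize $\sum_{e\in\overrightarrow{E}}c(e)x_e$ subject to $\sum_{e\in\delta^+(U)}x_e\ge 1$ for all $U\subseteq V\setminus\{r\}$ with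 $U\cap R\neq\emptyset$, and $x\ge 0$. *)

theory Defs
  imports Complex_Main "HOL-Library.Extended_Real"
begin

(* Undirected edges and demand pairs are sets {u, v}. The case u = v is not excluded. *)
definition ugraph :: "'a set \<Rightarrow> 'a set set \<Rightarrow> bool" where
  "ugraph V E \<longleftrightarrow> finite V \<and> E \<subseteq> {{u, v} | u v. u \<in> V \<and> v \<in> V}"

definition steiner_forest_instance ::
    "'a set \<Rightarrow> 'a set set \<Rightarrow> ('a set \<Rightarrow> real) \<Rightarrow> 'a set set \<Rightarrow> bool" where
  "steiner_forest_instance V E c \<P> \<longleftrightarrow>
     ugraph V E \<and> (\<forall>e\<in>E. 0 \<le> c e) \<and> \<P> \<subseteq> {{s, t} | s t. s \<in> V \<and> t \<in> V}"

definition arcs :: "'a set set \<Rightarrow> ('a \<times> 'a) set" where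
  "arcs E = {(u, v). {u, v} \<in> E}"

definition arc_cost :: "('a set \<Rightarrow> real) \<Rightarrow> 'a \<times> 'a \<Rightarrow> real" where
  "arc_cost c a = c {fst a, snd a}"

definition out_cut :: "'a set set \<Rightarrow> 'a set \<Rightarrow> ('a \<times> 'a) set" where
  "out_cut E U = {(u, v) \<in> arcs E. u \<in> U \<and> v \<notin> U}"

definition components :: "'a set \<Rightarrow> 'a set set \<Rightarrow> 'a set set" where
  "components V E = V // {(u, v) \<in> V \<times> V. (u, v) \<in> (arcs E)\<^sup>*}"

(* The demand graph of an instance is (V, \<P>). *)
definition nontrivial_demand_components :: "'a set \<Rightarrow> 'a set set \<Rightarrow> 'a set set" where
  "nontrivial_demand_components V \<P> = {C \<in> components V \<P>. card C > 1}"

definition forest_bcr_feasible ::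
    "'a set \<Rightarrow> 'a set set \<Rightarrow> 'a set set \<Rightarrow>
     ('a \<Rightarrow> 'a \<times> 'a \<Rightarrow> real) \<Rightarrow> ('a \<Rightarrow> 'a set \<Rightarrow> real) \<Rightarrow> bool" where
  "forest_bcr_feasible V E \<P> x z \<longleftrightarrow>
     (\<forall>P\<in>\<P>. (\<Sum>r\<in>V. z r P) = 1) \<and>
     (\<forall>r\<in>V. \<forall>P\<in>\<P>. \<forall>U. U \<subseteq> V - {r} \<and> P \<inter> U \<noteq> {} \<longrightarrow>
        (\<Sum>a\<in>out_cut E U. x r a) \<ge> z r P) \<and>
     (\<forall>r\<in>V. \<forall>a\<in>arcs E. x r a \<ge> 0) \<and>
     (\<forall>r\<in>V. \<forall>P\<in>\<P>. z r P \<ge> 0)"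

(* Optimum values are infima in ereal, so an infeasible program has value \<infinity>. *)
definition forest_bcr_opt ::
    "'a set \<Rightarrow> 'a set set \<Rightarrow> ('a set \<Rightarrow> real) \<Rightarrow> 'a set set \<Rightarrow> ereal" where
  "forest_bcr_opt V E c \<P> =
     (INF (x, z)\<in>{(x, z). forest_bcr_feasible V E \<P> x z}.
        ereal (\<Sum>r\<in>V. \<Sum>a\<in>arcs E. arc_cost c a * x r a))"

definition tree_bcr_feasible ::
    "'a set \<Rightarrow> 'a set set \<Rightarrow> 'a set \<Rightarrow> 'a \<Rightarrow> ('a \<times> 'a \<Rightarrow> real) \<Rightarrow> bool" where
  "tree_bcr_feasible V E R r x \<longleftrightarrow>
     (\<forall>U. U \<subseteq> V - {r} \<and> U \<inter> R \<noteq> {} \<longrightarrow> (\<Sum>a\<in>out_cut E U. x a) \<ge> 1) \<and>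
     (\<forall>a\<in>arcs E. x a \<ge> 0)"

definition tree_bcr_opt ::
    "'a set \<Rightarrow> 'a set set \<Rightarrow> ('a set \<Rightarrow> real) \<Rightarrow> 'a set \<Rightarrow> 'a \<Rightarrow> ereal" where
  "tree_bcr_opt V E c R r =
     (INF x\<in>{x. tree_bcr_feasible V E R r x}. ereal (\<Sum>a\<in>arcs E. arc_cost c a * x a))"

end

theory Submission
  imports Defs "HOL-Analysis.Function_Topology"
begin

text \<open>
  A Tree-BCR solution is a Forest-BCR solution that uses the single root \<open>r\<close>. Conversely, rank the
  vertices of \<open>R\<close>, starting with \<open>r\<close>, such that every other one has a demand partner of lower rank.
  For each root \<open>q\<close>, the solution \<open>x\<^sup>q\<close> is a fractional packing of connections of vertex sets to \<open>q\<close>.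
  Reversing flow changes no cost, since both orientations of an edge cost the same, and redirects
  each of these connections to its lowest-ranked vertex. Let \<open>U\<close> avoid \<open>r\<close> and meet \<open>R\<close>, let \<open>s\<close> be the
  lowest-ranked vertex of \<open>U\<close> and \<open>t\<close> its partner. The connections joining \<open>s\<close> and \<open>t\<close> have
  total weight at least 1 over all roots, and each of them leaves \<open>U\<close> because it is directed to a
  vertex of rank at most that of \<open>t\<close>.\<close>

section \<open>Cuts and reorientations\<close>

text \<open>The sum runs over all pairs of vertices, so that reorienting need not refer to the arcs;
  functions on arcs are extended by zero.\<close>

definition cut_value :: "'a set \<Rightarrow> ('a \<times> 'a \<Rightarrow> real) \<Rightarrow> 'a set \<Rightarrow> real" where
  "cut_value V x A = (\<Sum>a\<in>A \<times> (V - A). x a)"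

definition outflow :: "'a set \<Rightarrow> ('a \<times> 'a \<Rightarrow> real) \<Rightarrow> 'a \<Rightarrow> real" where
  "outflow V x v = (\<Sum>w\<in>V. x (v, w))"

text \<open>Only the total over both orientations of a pair is fixed. Where it is zero,
  nonnegativity makes \<open>y\<close> vanish too, so extension by zero off the arcs is
  preserved.\<close>

definition reorients :: "('a \<times> 'a \<Rightarrow> real) \<Rightarrow> ('a \<times> 'a \<Rightarrow> real) \<Rightarrow> bool" where
  "reorients x y \<longleftrightarrow> (\<forall>u v. 0 \<le> y (u, v) \<and> y (u, v) + y (v, u) = x (u, v) + x (v, u))"

lemma reorients_nonneg: "reorients x y \<Longrightarrow> 0 \<le> y a"
  by (cases a) (simp add: reorients_def)

lemma reorients_sum: "reorients x y \<Longrightarrow> y (u, v) + y (v, u) = x (u, v) + x (v, u)"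
  by (simp add: reorients_def)

lemma cut_value_nonneg: "(\<And>a. 0 \<le> x a) \<Longrightarrow> 0 \<le> cut_value V x A"
  by (simp add: cut_value_def sum_nonneg)

lemma sum_outflow:
  assumes "finite V" "A \<subseteq> V"
  shows "(\<Sum>v\<in>A. outflow V x v) = (\<Sum>u\<in>A. \<Sum>v\<in>A. x (u, v)) + cut_value V x A"
proof -
  have "outflow V x v = (\<Sum>w\<in>A. x (v, w)) + (\<Sum>w\<in>V - A. x (v, w))" for v
    unfolding outflow_def using assms by (metis add.commute sum.subset_diff)
  then show ?thesis
    by (simp add: sum.distrib cut_value_def sum.cartesian_product)
qed

lemma inner_sum_reorients:
  assumes "reorients x y"
  shows "(\<Sum>u\<in>A. \<Sum>v\<in>A. y (u, v)) = (\<Sum>u\<in>A. \<Sum>v\<in>A. x (u, v))"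
proof -
  have double: "2 * (\<Sum>u\<in>A. \<Sum>v\<in>A. f (u, v)) = (\<Sum>u\<in>A. \<Sum>v\<in>A. f (u, v) + f (v, u))"
    for f :: "'a \<times> 'a \<Rightarrow> real"
    using sum.swap[of "\<lambda>u v. f (u, v)" A A] by (simp add: sum.distrib)
  show ?thesis
    using double[of y] double[of x] by (simp add: reorients_sum[OF assms])
qed

text \<open>The total outflow of \<open>A\<close> counts both orientations of every pair inside
  \<open>A\<close>, and that part is invariant. All outflow lost by \<open>A\<close> is therefore
  lost across the cut.\<close>

lemma cut_reorients:
  assumes "finite V" "A \<subseteq> V" "reorients x y"
  shows "cut_value V y A = cut_value V x A - (\<Sum>v\<in>A. outflow V x v - outflow V y v)"
  using sum_outflow[OF assms(1,2), of x] sum_outflow[OF assms(1,2), of y]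
    inner_sum_reorients[OF assms(3), of A]
  by (simp add: sum_subtractf)

text \<open>Nothing leaves \<open>V\<close>, so the changes of outflow over \<open>V\<close> add up
  to zero. This form serves sets containing the root, where the change is not prescribed.\<close>

lemma cut_reorients_compl:
  assumes "finite V" "A \<subseteq> V" "reorients x y"
  shows "cut_value V y A = cut_value V x A + (\<Sum>v\<in>V - A. outflow V x v - outflow V y v)"
proof -
  have "cut_value V x V = 0" "cut_value V y V = 0" by (simp_all add: cut_value_def)
  then have "(\<Sum>v\<in>V. outflow V x v - outflow V y v) = 0"
    using cut_reorients[OF assms(1) subset_refl assms(3)] by simp
  then show ?thesis
    using cut_reorients[OF assms] sum.subset_diff[OF assms(2,1), of "\<lambda>v. outflow V x v - outflow V y v"]
    by linarith
qed

section \<open>Reorientations with prescribed losses of outflow\<close>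

text \<open>Both orientations are nonnegative with a fixed sum, which confines each coordinate to an
  interval. The product of these intervals is compact even for an infinite vertex type, and the
  constraints are closed.\<close>

lemma compact_reorientations:
  "compact {y. reorients x y \<and> (\<forall>v\<in>W. c v \<le> outflow V y v)}"
proof -
  let ?S = "\<lambda>(u, v). {0..x (u, v) + x (v, u)}"
  let ?B = "PiE UNIV ?S"
  have "compactin (product_topology (\<lambda>_. euclidean) UNIV) ?B"
    unfolding compactin_PiE by (auto simp: split_beta)
  then have B: "compact ?B"
    by (simp add: euclidean_product_topology flip: compactin_euclidean_iff)
  have [continuous_intros]: "continuous_on UNIV (\<lambda>y :: 'a \<times> 'a \<Rightarrow> real. y a)" for a
    by (rule continuous_on_product_coordinates)
  have closed: "closed {y. reorients x y \<and> (\<forall>v\<in>W. c v \<le> outflow V y v)}"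
    unfolding reorients_def outflow_def Ball_def
    by (intro closed_Collect_conj closed_Collect_all closed_Collect_imp closed_Collect_le
        closed_Collect_eq continuous_intros) auto
  have "{y. reorients x y \<and> (\<forall>v\<in>W. c v \<le> outflow V y v)} \<subseteq> ?B"
  proof (clarsimp simp: PiE_iff)
    fix y u v assume y: "reorients x y"
    show "0 \<le> y (u, v) \<and> y (u, v) \<le> x (u, v) + x (v, u)"
      using reorients_sum[OF y, of u v] reorients_nonneg[OF y, of "(u, v)"]
        reorients_nonneg[OF y, of "(v, u)"] by linarith
  qed
  then show ?thesis
    using compact_Int_closed[OF B closed] by (simp add: Int_absorb1)
qed

text \<open>Reversing an amount \<epsilon> on the arc from \<open>v\<close> to \<open>w\<close>
  shifts outflow, and with it undelivered supply, from \<open>v\<close> to \<open>w\<close>.\<close>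

definition push :: "real \<Rightarrow> 'a \<Rightarrow> 'a \<Rightarrow> ('a \<times> 'a \<Rightarrow> real) \<Rightarrow> 'a \<times> 'a \<Rightarrow> real" where
  "push \<epsilon> v w y = y((v, w) := y (v, w) - \<epsilon>, (w, v) := y (w, v) + \<epsilon>)"

lemma reorients_push:
  assumes "reorients x y" "v \<noteq> w" "0 \<le> \<epsilon>" "\<epsilon> \<le> y (v, w)"
  shows "reorients x (push \<epsilon> v w y)"
  using assms unfolding reorients_def push_def
  by (auto simp: add_nonneg_nonneg algebra_simps)

lemma outflow_push:
  assumes "finite V" "v \<in> V" "w \<in> V" "v \<noteq> w"
  shows "outflow V (push \<epsilon> v w y) u
    = outflow V y u - (if u = v then \<epsilon> else 0) + (if u = w then \<epsilon> else 0)"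
proof -
  have "push \<epsilon> v w y (u, t) = y (u, t) - (if t = w then if u = v then \<epsilon> else 0 else 0)
      + (if t = v then if u = w then \<epsilon> else 0 else 0)" for t
    using assms(4) by (auto simp: push_def)
  then show ?thesis
    using assms(1-3) by (simp add: outflow_def sum.distrib sum_subtractf sum.delta)
qed

text \<open>
  Among the reorientations that do not overshoot the supplies, take one with the least total
  remaining supply and, among these, with the most vertices that still have some. If supply
  remains, the cut condition yields an arc leaving the set of these vertices; pushing a little
  along it either delivers supply to \<open>q\<close> or enlarges the set.\<close>

lemma reorientation_realizing_supply:
  fixes x :: "'a \<times> 'a \<Rightarrow> real"
  assumes V: "finite V" "q \<in> V"
    and x: "\<And>a. 0 \<le> x a"
    and \<mu>: "\<And>v. v \<in> V \<Longrightarrow> 0 \<le> \<mu> v"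
    and cut: "\<And>A. A \<subseteq> V - {q} \<Longrightarrow> sum \<mu> A \<le> cut_value V x A"
  obtains y where "reorients x y" "\<And>v. v \<in> V - {q} \<Longrightarrow> outflow V x v - outflow V y v = \<mu> v"
proof -
  \<comment> \<open>A vertex \<open>v\<close> delivers its supply by losing outflow
    \<open>\<mu> v\<close>; \<open>left y v\<close> is the part of this loss still
    outstanding.\<close>
  define left where "left y v = outflow V y v - (outflow V x v - \<mu> v)" for y v
  define K where "K = {y. reorients x y \<and> (\<forall>v\<in>V - {q}. outflow V x v - \<mu> v \<le> outflow V y v)}"
  have K: "y \<in> K \<longleftrightarrow> reorients x y \<and> (\<forall>v\<in>V - {q}. 0 \<le> left y v)" for y
    by (simp add: K_def left_def)
  define \<Phi> where "\<Phi> y = (\<Sum>v\<in>V - {q}. left y v)" for y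
  have [continuous_intros]: "continuous_on K (\<lambda>y :: 'a \<times> 'a \<Rightarrow> real. y a)" for a
    by (rule continuous_on_subset[OF continuous_on_product_coordinates subset_UNIV])
  have "compact K" unfolding K_def by (rule compact_reorientations)
  moreover have "x \<in> K" using x \<mu> by (simp add: K reorients_def left_def)
  moreover have "continuous_on K \<Phi>"
    unfolding \<Phi>_def left_def outflow_def by (intro continuous_intros)
  ultimately obtain y0 where y0: "y0 \<in> K" "\<And>y. y \<in> K \<Longrightarrow> \<Phi> y0 \<le> \<Phi> y"
    using continuous_attains_inf[of K \<Phi>] by blast
  define pos where "pos y = {v \<in> V - {q}. 0 < left y v}" for y
  have fin: "finite (pos y)" for y using V by (simp add: pos_def)
  have "card (pos y) \<le> card V" for y
    using V by (intro card_mono) (auto simp: pos_def)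
  then obtain y where y: "y \<in> K" "\<Phi> y \<le> \<Phi> y0"
    and max: "\<And>y'. y' \<in> K \<Longrightarrow> \<Phi> y' \<le> \<Phi> y0 \<Longrightarrow> card (pos y') \<le> card (pos y)"
    using ex_has_greatest_nat[of "\<lambda>y. y \<in> K \<and> \<Phi> y \<le> \<Phi> y0" y0 "\<lambda>y. card (pos y)" "Suc (card V)"] y0(1)
    by (auto simp: less_Suc_eq_le)
  have ro: "reorients x y" using y(1) K by blast
  have "pos y = {}"
  proof (rule ccontr)
    assume ne: "pos y \<noteq> {}"
    have sub: "pos y \<subseteq> V - {q}" by (auto simp: pos_def)
    \<comment> \<open>By \<open>cut_reorients\<close>, the cut condition for \<open>x\<close> and
      \<mu> turns into one for \<open>y\<close> and the remaining supply.\<close>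
    have "0 < sum (left y) (pos y)"
      using ne fin by (intro sum_pos) (auto simp: pos_def)
    also have "\<dots> \<le> cut_value V y (pos y)"
      using cut[OF sub] cut_reorients[OF V(1) subset_trans[OF sub Diff_subset] ro]
      by (simp add: left_def sum_subtractf)
    finally have "\<not> (\<forall>a\<in>pos y \<times> (V - pos y). y a \<le> 0)"
      unfolding cut_value_def by (rule contrapos_pn) (simp only: not_less, blast intro: sum_nonpos)
    then obtain v w where vw: "v \<in> pos y" "w \<in> V" "w \<notin> pos y" "0 < y (v, w)"
      by (auto simp: not_le)
    \<comment> \<open>Halving keeps the supply at \<open>v\<close> strictly positive, so
      \<open>v\<close> stays in \<open>pos\<close> when \<open>w\<close> joins it.\<close>
    define \<epsilon> where "\<epsilon> = min (y (v, w)) (left y v) / 2"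
    have v: "v \<in> V" "v \<noteq> q" "v \<noteq> w" "0 < left y v" using vw by (auto simp: pos_def)
    have \<epsilon>: "0 < \<epsilon>" "\<epsilon> \<le> y (v, w)" "\<epsilon> < left y v" using v vw by (auto simp: \<epsilon>_def)
    let ?y = "push \<epsilon> v w y"
    have left: "left ?y u = left y u - (if u = v then \<epsilon> else 0) + (if u = w then \<epsilon> else 0)" for u
      using outflow_push[OF V(1) v(1) vw(2) v(3)] by (simp add: left_def)
    have "reorients x ?y" using ro v \<epsilon> by (intro reorients_push) auto
    moreover have "0 \<le> left ?y u" if "u \<in> V - {q}" for u
      using that y(1) \<epsilon> v(3) by (auto simp: K left)
    ultimately have K': "?y \<in> K" by (simp add: K)
    have \<Phi>': "\<Phi> ?y = \<Phi> y - \<epsilon> + (if w = q then 0 else \<epsilon>)"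
      using V v vw by (simp add: \<Phi>_def left sum.distrib sum_subtractf sum.delta)
    show False
    proof (cases "w = q")
      case True
      then show False using \<Phi>' \<epsilon> y(2) y0(2)[OF K'] by simp
    next
      case False
      have "insert w (pos y) \<subseteq> pos ?y"
        using False vw v(3) \<epsilon> y(1) by (auto simp: pos_def left K add_nonneg_pos)
      then have "card (pos y) < card (pos ?y)"
        using vw(3) fin by (metis card_mono card_insert_disjoint Suc_le_eq)
      then show False using max[OF K'] \<Phi>' y(2) False by simp
    qed
  qed
  then have "left y v = 0" if "v \<in> V - {q}" for v
    using that y(1) by (auto simp: pos_def K order.antisym not_less)
  then show thesis using that[OF ro] by (simp add: left_def)
qed

section \<open>Reorienting one root towards low ranks\<close>

text \<open>
  Think of \<open>y\<close> as a stack of hyperedges \<open>{v. \<lambda> \<le> y v}\<close>, one for every level \<open>\<lambda>\<close>. The supply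
  given to a vertex is the measure of the hyperedges whose lowest-ranked vertex it is, so that
  after the reorientation each hyperedge is directed to its lowest-ranked vertex instead of \<open>q\<close>.\<close>

lemma reorientation_towards_low_rank:
  fixes x :: "'a \<times> 'a \<Rightarrow> real" and d :: "'a \<Rightarrow> nat"
  assumes V: "finite V" "q \<in> V" "R \<subseteq> V"
    and x: "\<And>a. 0 \<le> x a"
    and d: "inj_on d R"
    and y: "\<And>v. v \<in> R \<Longrightarrow> 0 \<le> y v"
    and cut: "\<And>A v. A \<subseteq> V - {q} \<Longrightarrow> v \<in> A \<inter> R \<Longrightarrow> y v \<le> cut_value V x A"
  shows "\<exists>x'. reorients x x' \<and> (\<forall>U s t. U \<subseteq> V \<longrightarrow> s \<in> U \<inter> R \<longrightarrow> t \<in> R \<longrightarrow>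
    (\<forall>v\<in>U \<inter> R. d t < d v) \<longrightarrow> min (y s) (y t) \<le> cut_value V x' U)"
proof -
  have finR: "finite R" using V finite_subset by blast
  \<comment> \<open>\<open>G k\<close> is the measure of the levels reached by some vertex of rank
    below \<open>k\<close>. The added 0 covers the case of no such vertex.\<close>
  define G where "G k = Max (insert 0 (y ` {v \<in> R. d v < k}))" for k
  have fin: "finite (y ` {v \<in> R. d v < k})" for k using finR by simp
  have G_nonneg: "0 \<le> G k" for k unfolding G_def using fin by simp
  have G_mono: "G j \<le> G k" if "j \<le> k" for j k
    unfolding G_def using that fin by (intro Max_mono) auto
  have G_ge: "y v \<le> G k" if "v \<in> R" "d v < k" for v k
    unfolding G_def using that fin by (intro Max_ge) auto
  have G_Suc: "G (Suc (d v)) = max (G (d v)) (y v)" if "v \<in> R" for v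
  proof -
    have "{w \<in> R. d w < Suc (d v)} = insert v {w \<in> R. d w < d v}"
      using that d by (auto simp: less_Suc_eq inj_on_def)
    then have "insert 0 (y ` {w \<in> R. d w < Suc (d v)}) = insert (y v) (insert 0 (y ` {w \<in> R. d w < d v}))"
      by auto
    then show ?thesis unfolding G_def using fin by (simp add: max.commute)
  qed
  \<comment> \<open>The levels in this increment reach \<open>v\<close> but no vertex of lower
    rank.\<close>
  define \<mu> where "\<mu> v = (if v \<in> R then G (Suc (d v)) - G (d v) else 0)" for v
  have \<mu>_nonneg: "0 \<le> \<mu> v" for v by (simp add: \<mu>_def G_mono)
  have sum_\<mu>: "sum \<mu> {v \<in> R. d v < k} = G k" for k
  proof (induction k)
    case 0
    then show ?case by (simp add: G_def)
  next
    case (Suc k)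
    show ?case
    proof (cases "\<exists>v\<in>R. d v = k")
      case True
      then obtain v where v: "v \<in> R" "d v = k" by blast
      then have "{w \<in> R. d w < Suc k} = insert v {w \<in> R. d w < k}"
        using d by (auto simp: less_Suc_eq inj_on_def)
      then show ?thesis using v Suc finR by (simp add: \<mu>_def)
    next
      case False
      then have "{w \<in> R. d w < Suc k} = {w \<in> R. d w < k}"
        by (auto simp: less_Suc_eq)
      then show ?thesis using Suc by (simp add: G_def)
    qed
  qed
  \<comment> \<open>The vertices of \<open>R\<close> with rank below \<open>k\<close> lie outside
    \<open>A\<close> and have total supply \<open>G k\<close>. Together with \<open>A\<close> they
    supply at most \<open>G (Suc (d w)) = y w\<close>, where \<open>w\<close> is the last vertex of
    \<open>A\<close> with positive supply, and \<open>y w\<close> is a lower bound for the cut.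
    Taking \<open>k = 0\<close> gives the cut condition for \<mu>; \<open>k = Suc (d t)\<close>
    leaves at least \<open>G k\<close> on the cut after reorientation.\<close>
  have bound: "y v \<le> cut_value V x A \<and> sum \<mu> A + G k \<le> cut_value V x A"
    if A: "A \<subseteq> V - {q}" and v: "v \<in> A \<inter> R" and k: "G k \<le> cut_value V x A"
      "\<And>w. w \<in> A \<inter> R \<Longrightarrow> k \<le> d w" for A v k
  proof
    show "y v \<le> cut_value V x A" using cut A v by blast
    define W where "W = {w \<in> A \<inter> R. 0 < \<mu> w}"
    have finA: "finite A" using A V finite_subset by blast
    have \<mu>W: "sum \<mu> A = sum \<mu> W"
      using finA \<mu>_nonneg
      by (intro sum.mono_neutral_right) (auto simp: W_def \<mu>_def not_less order.antisym)
    show "sum \<mu> A + G k \<le> cut_value V x A"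
    proof (cases "W = {}")
      case True
      then show ?thesis using \<mu>W k(1) by simp
    next
      case False
      have "finite W" using finA by (simp add: W_def)
      then have "Max (d ` W) \<in> d ` W" using False by (intro Max_in) auto
      then obtain w where w: "w \<in> W" "d w = Max (d ` W)" by auto
      have last: "d u \<le> d w" if "u \<in> W" for u
        using that \<open>finite W\<close> w(2) by simp
      have "sum \<mu> A + G k = sum \<mu> W + sum \<mu> {v \<in> R. d v < k}"
        using \<mu>W sum_\<mu> by simp
      also have "\<dots> = sum \<mu> (W \<union> {v \<in> R. d v < k})"
        using \<open>finite W\<close> finR k(2) by (intro sum.union_disjoint[symmetric]) (auto simp: W_def not_less[symmetric])
      also have "\<dots> \<le> sum \<mu> {v \<in> R. d v < Suc (d w)}"
        using finR last k(2)[of w] w(1) \<mu>_nonneg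
        by (intro sum_mono2) (auto simp: W_def less_Suc_eq_le)
      also have "\<dots> = G (Suc (d w))" by (rule sum_\<mu>)
      also have "\<dots> = y w"
        using w(1) G_Suc[of w] by (auto simp: W_def \<mu>_def max_def split: if_splits)
      also have "\<dots> \<le> cut_value V x A" using cut[OF A, of w] w(1) by (simp add: W_def)
      finally show ?thesis .
    qed
  qed
  have supplies: "sum \<mu> A \<le> cut_value V x A" if A: "A \<subseteq> V - {q}" for A
  proof (cases "A \<inter> R = {}")
    case True
    then have "sum \<mu> A = 0" by (intro sum.neutral) (auto simp: \<mu>_def)
    then show ?thesis using cut_value_nonneg x by metis
  next
    case False
    then obtain v where "v \<in> A \<inter> R" by blast
    moreover have "G 0 = 0" by (simp add: G_def)
    ultimately show ?thesis using bound[OF A, of v 0] cut_value_nonneg[of x] x by simp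
  qed
  obtain x' where ro: "reorients x x'"
    and x': "\<And>v. v \<in> V - {q} \<Longrightarrow> outflow V x v - outflow V x' v = \<mu> v"
    using reorientation_realizing_supply[OF V(1,2) x \<mu>_nonneg supplies] by metis
  have "min (y s) (y t) \<le> cut_value V x' U"
    if U: "U \<subseteq> V" and s: "s \<in> U \<inter> R" and t: "t \<in> R" and low: "\<forall>v\<in>U \<inter> R. d t < d v"
    for U s t
  proof (cases "q \<in> U")
    case False
    then have A: "U \<subseteq> V - {q}" using U by auto
    have eq: "cut_value V x' U = cut_value V x U - sum \<mu> U"
      using cut_reorients[OF V(1) U ro] x' A by (simp add: subset_iff)
    \<comment> \<open>The minimum reflects two cases. Either the cut keeps at least
      \<open>y t\<close> after losing the supply of \<open>U\<close>, or the ranks up to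
      \<open>d t\<close> already reach all levels up to the cut value. Then no vertex of
      \<open>U\<close> has supply, and the cut keeps its value, at least \<open>y s\<close>.\<close>
    show ?thesis
    proof (cases "G (Suc (d t)) \<le> cut_value V x U")
      case True
      then show ?thesis
        using bound[OF A s True] low G_ge[OF t, of "Suc (d t)"] eq by (auto simp: Suc_le_eq)
    next
      case large: False
      have "\<mu> v = 0" if "v \<in> U" for v
      proof (rule ccontr)
        assume "\<mu> v \<noteq> 0"
        then have "v \<in> R" "G (d v) < y v"
          using G_Suc[of v] by (auto simp: \<mu>_def max_def split: if_splits)
        moreover have "y v \<le> cut_value V x U" using cut[OF A] that \<open>v \<in> R\<close> by blast
        moreover have "G (Suc (d t)) \<le> G (d v)" using low that \<open>v \<in> R\<close> by (intro G_mono Suc_leI) blast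
        ultimately show False using large by simp
      qed
      then show ?thesis using eq cut[OF A s] by simp
    qed
  next
    case True
    \<comment> \<open>The vertices of \<open>R\<close> with rank at most \<open>d t\<close> all lie
      outside \<open>U\<close>. Their supply totals at least \<open>y t\<close>, and the outflow
      lost outside \<open>U\<close> reappears on the cut of \<open>U\<close>.\<close>
    have "y t \<le> sum \<mu> {v \<in> R. d v < Suc (d t)}"
      using G_ge[OF t, of "Suc (d t)"] by (simp add: sum_\<mu>)
    also have "\<dots> \<le> sum \<mu> (V - U)"
      using V \<mu>_nonneg low by (intro sum_mono2) (auto simp: less_Suc_eq_le dest!: leD[where ?'a = nat])
    also have "\<dots> = (\<Sum>v\<in>V - U. outflow V x v - outflow V x' v)"
      using x' True by (intro sum.cong refl x'[symmetric]) auto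
    also have "\<dots> \<le> cut_value V x' U"
      using cut_reorients_compl[OF V(1) U ro] cut_value_nonneg[of x V U] x by simp
    finally show ?thesis by simp
  qed
  then show ?thesis using ro by blast
qed

section \<open>Transferring solutions\<close>

lemma out_cut_eq: "U \<subseteq> V \<Longrightarrow> arcs E \<subseteq> V \<times> V \<Longrightarrow> out_cut E U = arcs E \<inter> U \<times> (V - U)"
  by (auto simp: out_cut_def)

lemma cut_value_eq_sum_out_cut:
  assumes "finite V" "U \<subseteq> V" "arcs E \<subseteq> V \<times> V"
  shows "cut_value V (\<lambda>a. if a \<in> arcs E then x a else 0) U = sum x (out_cut E U)"
proof -
  have "finite (U \<times> (V - U))" using assms finite_subset by blast
  from sum.inter_restrict[OF this, of x "arcs E"] show ?thesis
    by (simp add: cut_value_def out_cut_eq[OF assms(2,3)] Int_commute)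
qed

lemma cost_reorients:
  assumes "reorients x y"
  shows "(\<Sum>a\<in>arcs E. arc_cost c a * y a) = (\<Sum>a\<in>arcs E. arc_cost c a * x a)"
proof -
  have double: "2 * (\<Sum>a\<in>arcs E. arc_cost c a * f a)
      = (\<Sum>a\<in>arcs E. arc_cost c a * (f a + f (prod.swap a)))" for f :: "'a \<times> 'a \<Rightarrow> real"
  proof -
    have "bij_betw prod.swap (arcs E) (arcs E)"
      by (rule bij_betw_byWitness[where f' = prod.swap]) (auto simp: arcs_def insert_commute)
    then have "(\<Sum>a\<in>arcs E. arc_cost c a * f a)
        = (\<Sum>a\<in>arcs E. arc_cost c (prod.swap a) * f (prod.swap a))"
      by (rule sum.reindex_bij_betw[symmetric])
    then show ?thesis
      by (simp add: arc_cost_def insert_commute distrib_left sum.distrib)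
  qed
  have "y a + y (prod.swap a) = x a + x (prod.swap a)" for a
    using reorients_sum[OF assms] by (cases a) simp
  then show ?thesis
    using double[of x] double[of y] by simp
qed

text \<open>The ranked set grows from \<rho> one vertex at a time: \<open>grow\<close> yields a
  vertex with a partner already ranked, and it is placed above all earlier ranks.\<close>

lemma increasing_rank:
  fixes \<P> :: "'a set set"
  assumes R: "finite R" "\<rho> \<in> R"
    and grow: "\<And>S. \<rho> \<in> S \<Longrightarrow> S \<subset> R \<Longrightarrow> \<exists>s\<in>R - S. \<exists>t\<in>S. {s, t} \<in> \<P>"
  obtains d :: "'a \<Rightarrow> nat" where "inj_on d R"
    "\<And>s. s \<in> R - {\<rho>} \<Longrightarrow> \<exists>t\<in>R. {s, t} \<in> \<P> \<and> d t < d s"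
proof -
  define ranked where "ranked S d \<longleftrightarrow> \<rho> \<in> S \<and> S \<subseteq> R \<and> inj_on d S \<and>
    (\<forall>s\<in>S - {\<rho>}. \<exists>t\<in>S. {s, t} \<in> \<P> \<and> d t < d s)" for S and d :: "'a \<Rightarrow> nat"
  have "\<exists>S d. ranked S d \<and> card S = Suc n" if "Suc n \<le> card R" for n
    using that
  proof (induction n)
    case 0
    have "ranked {\<rho>} (\<lambda>_. 0)" using R by (simp add: ranked_def)
    then show ?case by fastforce
  next
    case (Suc n)
    then obtain S d where S: "ranked S d" "card S = Suc n" by auto
    then have "S \<subset> R" using Suc.prems by (auto simp: ranked_def)
    moreover have "\<rho> \<in> S" using S by (simp add: ranked_def)
    ultimately obtain s t where st: "s \<in> R" "s \<notin> S" "t \<in> S" "{s, t} \<in> \<P>"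
      using grow[of S] by blast
    have fin: "finite S" using S(2) card.infinite by fastforce
    define d' where "d' = d(s := Suc (Max (d ` S)))"
    have less: "d' u < d' s" and same: "d' u = d u" if "u \<in> S" for u
      using that st fin by (auto simp: d'_def less_Suc_eq_le)
    have "inj_on d' S" using S(1) same by (auto simp: ranked_def inj_on_def)
    moreover have "d' s \<notin> d' ` S" using less by (metis imageE less_irrefl)
    ultimately have "inj_on d' (insert s S)" using st by simp
    moreover have "\<exists>t\<in>insert s S. {u, t} \<in> \<P> \<and> d' t < d' u" if "u \<in> insert s S - {\<rho>}" for u
    proof (cases "u = s")
      case True
      then show ?thesis using st less by blast
    next
      case False
      then have "u \<in> S - {\<rho>}" using that by blast
      then obtain t where "t \<in> S" "{u, t} \<in> \<P>" "d t < d u"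
        using S(1) unfolding ranked_def by blast
      then show ?thesis using \<open>u \<in> S - {\<rho>}\<close> same by auto
    qed
    ultimately have "ranked (insert s S) d'"
      using S(1) st by (simp add: ranked_def)
    moreover have "card (insert s S) = Suc (Suc n)" using S st fin by simp
    ultimately show ?case by blast
  qed
  moreover have "Suc (card R - 1) = card R" using R card_gt_0_iff[of R] by auto
  ultimately obtain S d where "ranked S d" "card S = card R" by (metis order_refl)
  moreover from this have "S = R" using R(1) by (intro card_subset_eq) (auto simp: ranked_def)
  ultimately show thesis using that unfolding ranked_def by blast
qed

lemma tree_solution_of_forest_solution:
  fixes E :: "'a set set"
  assumes V: "finite V" "arcs E \<subseteq> V \<times> V" "R \<subseteq> V" "\<rho> \<in> R" and \<P>: "finite \<P>"
    and grow: "\<And>S. \<rho> \<in> S \<Longrightarrow> S \<subset> R \<Longrightarrow> \<exists>s\<in>R - S. \<exists>t\<in>S. {s, t} \<in> \<P>"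
    and feas: "forest_bcr_feasible V E \<P> x z"
  obtains x' where "tree_bcr_feasible V E R \<rho> x'"
    "(\<Sum>a\<in>arcs E. arc_cost c a * x' a) = (\<Sum>r\<in>V. \<Sum>a\<in>arcs E. arc_cost c a * x r a)"
proof -
  have finR: "finite R" using V finite_subset by blast
  obtain d :: "'a \<Rightarrow> nat" where d: "inj_on d R"
    and parent: "\<And>s. s \<in> R - {\<rho>} \<Longrightarrow> \<exists>t\<in>R. {s, t} \<in> \<P> \<and> d t < d s"
    using increasing_rank[OF finR V(4) grow] by metis
  define x0 where "x0 q a = (if a \<in> arcs E then x q a else 0)" for q a
  \<comment> \<open>The most that any pair at \<open>v\<close> asks of the root \<open>q\<close>, or
    0 if \<open>v\<close> is in no pair. Thus \<open>z q {s, t}\<close> is at most both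
    \<open>y q s\<close> and \<open>y q t\<close>, while the cut bounds for \<open>y\<close> still
    follow from those for single pairs.\<close>
  define y where "y q v = Max (insert 0 (z q ` {P \<in> \<P>. v \<in> P}))" for q v
  have x0_nonneg: "0 \<le> x0 q a" if "q \<in> V" for q a
    using feas that by (simp add: x0_def forest_bcr_feasible_def)
  have x0_cut: "cut_value V (x0 q) U = sum (x q) (out_cut E U)" if "U \<subseteq> V" for q U
    unfolding x0_def by (rule cut_value_eq_sum_out_cut[OF V(1) that V(2)])
  have y_ge: "z q P \<le> y q v" if "P \<in> \<P>" "v \<in> P" for q P v
    unfolding y_def using that \<P> by (intro Max_ge) auto
  have "\<exists>x'. reorients (x0 q) x' \<and> (\<forall>U s t. U \<subseteq> V \<longrightarrow> s \<in> U \<inter> R \<longrightarrow> t \<in> R \<longrightarrow>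
      (\<forall>v\<in>U \<inter> R. d t < d v) \<longrightarrow> min (y q s) (y q t) \<le> cut_value V x' U)"
    if q: "q \<in> V" for q
  proof -
    have "0 \<le> y q v" for v
      unfolding y_def using \<P> by (intro Max_ge) auto
    moreover have "y q v \<le> cut_value V (x0 q) A" if "A \<subseteq> V - {q}" "v \<in> A \<inter> R" for A v
    proof -
      have "z q P \<le> cut_value V (x0 q) A" if "P \<in> \<P>" "v \<in> P" for P
      proof -
        have "A \<subseteq> V" "P \<inter> A \<noteq> {}"
          using that \<open>A \<subseteq> V - {q}\<close> \<open>v \<in> A \<inter> R\<close> by blast+
        then show ?thesis
          using feas \<open>P \<in> \<P>\<close> q \<open>A \<subseteq> V - {q}\<close> by (simp add: forest_bcr_feasible_def x0_cut)
      qed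
      then show ?thesis
        unfolding y_def using \<P> cut_value_nonneg[OF x0_nonneg[OF q]] by simp
    qed
    ultimately show ?thesis
      by (rule reorientation_towards_low_rank[OF V(1) q V(3) x0_nonneg[OF q] d])
  qed
  then obtain x' where "\<forall>q\<in>V. reorients (x0 q) (x' q) \<and> (\<forall>U s t. U \<subseteq> V \<longrightarrow> s \<in> U \<inter> R \<longrightarrow>
      t \<in> R \<longrightarrow> (\<forall>v\<in>U \<inter> R. d t < d v) \<longrightarrow> min (y q s) (y q t) \<le> cut_value V (x' q) U)"
    using bchoice[of V "\<lambda>q x'. reorients (x0 q) x' \<and> (\<forall>U s t. U \<subseteq> V \<longrightarrow> s \<in> U \<inter> R \<longrightarrow>
      t \<in> R \<longrightarrow> (\<forall>v\<in>U \<inter> R. d t < d v) \<longrightarrow> min (y q s) (y q t) \<le> cut_value V x' U)"]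
    by blast
  then have ro: "\<And>q. q \<in> V \<Longrightarrow> reorients (x0 q) (x' q)"
    and x': "\<And>q U s t. q \<in> V \<Longrightarrow> U \<subseteq> V \<Longrightarrow> s \<in> U \<inter> R \<Longrightarrow> t \<in> R \<Longrightarrow>
      (\<And>v. v \<in> U \<inter> R \<Longrightarrow> d t < d v) \<Longrightarrow> min (y q s) (y q t) \<le> cut_value V (x' q) U"
    by blast+
  have x'_nonneg: "0 \<le> x' q a" if "q \<in> V" for q a
    using reorients_nonneg[OF ro[OF that]] .
  have x'_zero: "x' q a = 0" if "q \<in> V" "a \<notin> arcs E" for q a
  proof (cases a)
    case (Pair u v)
    then have "x0 q (u, v) = 0" "x0 q (v, u) = 0"
      using that(2) by (auto simp: x0_def arcs_def insert_commute)
    then show ?thesis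
      using reorients_sum[OF ro[OF that(1)], of u v] x'_nonneg[OF that(1)] Pair
      by (simp add: add_nonneg_eq_0_iff)
  qed
  have x'_cut: "cut_value V (x' q) U = sum (x' q) (out_cut E U)" if "q \<in> V" "U \<subseteq> V" for q U
  proof -
    have "x' q = (\<lambda>a. if a \<in> arcs E then x' q a else 0)"
      using x'_zero[OF that(1)] by auto
    then show ?thesis using cut_value_eq_sum_out_cut[OF V(1) that(2) V(2)] by metis
  qed
  define X where "X a = (\<Sum>q\<in>V. x' q a)" for a
  have "tree_bcr_feasible V E R \<rho> X"
    unfolding tree_bcr_feasible_def
  proof (intro conjI ballI allI impI)
    fix a assume "a \<in> arcs E"
    show "0 \<le> X a" unfolding X_def by (intro sum_nonneg x'_nonneg)
  next
    fix U assume U: "U \<subseteq> V - {\<rho>} \<and> U \<inter> R \<noteq> {}"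
    then obtain s where s: "s \<in> U \<inter> R" and first: "\<And>v. v \<in> U \<inter> R \<Longrightarrow> d s \<le> d v"
      using ex_has_least_nat[of "\<lambda>v. v \<in> U \<inter> R" _ d] by blast
    then obtain t where t: "t \<in> R" "{s, t} \<in> \<P>" "d t < d s"
      using parent[of s] U by blast
    have sub: "U \<subseteq> V" using U by blast
    have "1 = (\<Sum>q\<in>V. z q {s, t})"
      using feas t(2) by (simp add: forest_bcr_feasible_def)
    also have "\<dots> \<le> (\<Sum>q\<in>V. cut_value V (x' q) U)"
    proof (rule sum_mono)
      fix q assume q: "q \<in> V"
      have "z q {s, t} \<le> min (y q s) (y q t)"
        using y_ge[OF t(2)] by simp
      also have "\<dots> \<le> cut_value V (x' q) U"
        using x'[OF q sub s t(1)] first t(3) by (meson order.strict_trans2)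
      finally show "z q {s, t} \<le> cut_value V (x' q) U" .
    qed
    also have "\<dots> = sum X (out_cut E U)"
      unfolding X_def by (subst sum.swap) (simp add: x'_cut sub)
    finally show "1 \<le> sum X (out_cut E U)" .
  qed
  moreover have "(\<Sum>a\<in>arcs E. arc_cost c a * X a) = (\<Sum>r\<in>V. \<Sum>a\<in>arcs E. arc_cost c a * x r a)"
  proof -
    have "(\<Sum>a\<in>arcs E. arc_cost c a * X a) = (\<Sum>q\<in>V. \<Sum>a\<in>arcs E. arc_cost c a * x' q a)"
      unfolding X_def by (subst sum.swap) (simp add: sum_distrib_left)
    also have "\<dots> = (\<Sum>q\<in>V. \<Sum>a\<in>arcs E. arc_cost c a * x0 q a)"
      by (rule sum.cong[OF refl cost_reorients[OF ro]])
    also have "\<dots> = (\<Sum>q\<in>V. \<Sum>a\<in>arcs E. arc_cost c a * x q a)"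
      by (intro sum.cong) (auto simp: x0_def)
    finally show ?thesis .
  qed
  ultimately show thesis using that by blast
qed

lemma forest_solution_of_tree_solution:
  fixes E :: "'a set set"
  assumes V: "finite V" "\<rho> \<in> V"
    and \<P>: "\<And>P. P \<in> \<P> \<Longrightarrow> P \<subseteq> R \<or> (\<exists>s\<in>V. P = {s})"
    and feas: "tree_bcr_feasible V E R \<rho> x"
  obtains x' z where "forest_bcr_feasible V E \<P> x' z"
    "(\<Sum>r\<in>V. \<Sum>a\<in>arcs E. arc_cost c a * x' r a) = (\<Sum>a\<in>arcs E. arc_cost c a * x a)"
proof
  \<comment> \<open>A degenerate pair \<open>{s, s}\<close> outside \<open>R\<close> is served for free by the root \<open>s\<close>.\<close>
  let ?x = "\<lambda>r a. if r = \<rho> then x a else 0"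
  let ?z = "\<lambda>r P. if if P \<subseteq> R then r = \<rho> else P = {r} then 1 else 0 :: real"
  have x: "0 \<le> x a" if "a \<in> arcs E" for a
    using feas that by (simp add: tree_bcr_feasible_def)
  show "forest_bcr_feasible V E \<P> ?x ?z"
    unfolding forest_bcr_feasible_def
  proof (intro conjI ballI allI impI)
    fix P assume "P \<in> \<P>"
    show "(\<Sum>r\<in>V. ?z r P) = 1"
    proof (cases "P \<subseteq> R")
      case True
      then show ?thesis using V by simp
    next
      case False
      then obtain s where "s \<in> V" "P = {s}" using \<P>[OF \<open>P \<in> \<P>\<close>] by blast
      then show ?thesis using V False by (simp add: sum.delta)
    qed
  next
    fix r P U assume *: "r \<in> V" "P \<in> \<P>" "U \<subseteq> V - {r} \<and> P \<inter> U \<noteq> {}"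
    have nonneg: "0 \<le> sum (?x r) (out_cut E U)"
      using x by (intro sum_nonneg) (auto simp: out_cut_def)
    show "?z r P \<le> sum (?x r) (out_cut E U)"
    proof (cases "P \<subseteq> R \<and> r = \<rho>")
      case True
      then have "U \<subseteq> V - {\<rho>}" "U \<inter> R \<noteq> {}" using * by blast+
      then show ?thesis using True feas unfolding tree_bcr_feasible_def by simp
    next
      case False
      \<comment> \<open>The other way to have \<open>?z r P = 1\<close> is \<open>P = {r}\<close>,
        but then no \<open>U\<close> avoiding \<open>r\<close> meets \<open>P\<close>.\<close>
      then have "?z r P = 0" using * by auto
      then show ?thesis using nonneg by simp
    qed
  qed (use x in auto)
  show "(\<Sum>r\<in>V. \<Sum>a\<in>arcs E. arc_cost c a * ?x r a) = (\<Sum>a\<in>arcs E. arc_cost c a * x a)"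
  proof -
    have "(\<Sum>a\<in>arcs E. arc_cost c a * ?x r a)
        = (if r = \<rho> then \<Sum>a\<in>arcs E. arc_cost c a * x a else 0)" for r by simp
    then show ?thesis using V by simp
  qed
qed

section \<open>The demand component\<close>

text \<open>A demand path from \<rho> to a vertex of \<open>R\<close> outside \<open>S\<close> has
  an arc leaving \<open>S\<close>, and the component contains the head of that arc because it
  contains the tail.\<close>

lemma component_expands:
  assumes "R \<in> Defs.components V \<P>" "\<rho> \<in> R" "\<rho> \<in> S" "S \<subset> R" "arcs \<P> \<subseteq> V \<times> V"
  shows "\<exists>s\<in>R - S. \<exists>t\<in>S. {s, t} \<in> \<P>"
proof -
  obtain a where a: "a \<in> V" "R = {v \<in> V. (a, v) \<in> (arcs \<P>)\<^sup>*}"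
    using assms(1) by (auto simp: Defs.components_def quotient_def)
  have sym: "sym ((arcs \<P>)\<^sup>*)"
    by (intro sym_rtrancl symI) (auto simp: arcs_def insert_commute)
  obtain u where u: "u \<in> R" "u \<notin> S" using assms(4) by blast
  have "(\<rho>, u) \<in> (arcs \<P>)\<^sup>*"
    using a assms(2) u sym by (metis (mono_tags, lifting) mem_Collect_eq rtrancl_trans symD)
  then have "u \<in> S \<or> (\<exists>s t. (t, s) \<in> arcs \<P> \<and> t \<in> S \<and> s \<notin> S)"
    using assms(3) by (induction) blast+
  then obtain s t where st: "(t, s) \<in> arcs \<P>" "t \<in> S" "s \<notin> S" using u by blast
  have "t \<in> R" using st assms(4) by blast
  then have "(a, s) \<in> (arcs \<P>)\<^sup>*" using a st by auto
  then have "s \<in> R" using a st assms(5) by blast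
  then show ?thesis using st by (auto simp: arcs_def insert_commute)
qed

text \<open>Two distinct partners make the class of \<open>s\<close> nontrivial, and
  \<open>R\<close> is the only such class.\<close>

lemma pair_in_nontrivial_component:
  assumes V: "finite V" "arcs \<P> \<subseteq> V \<times> V"
    and R: "nontrivial_demand_components V \<P> = {R}"
    and st: "{s, t} \<in> \<P>" "s \<noteq> t"
  shows "{s, t} \<subseteq> R"
proof -
  define C where "C = {(u, v) \<in> V \<times> V. (u, v) \<in> (arcs \<P>)\<^sup>*} `` {s}"
  have "(s, t) \<in> arcs \<P>" using st by (simp add: arcs_def)
  then have sub: "{s, t} \<subseteq> C" "s \<in> V" using V(2) by (auto simp: C_def)
  have "finite C" using V(1) by (rule finite_subset[rotated]) (auto simp: C_def)
  then have "card {s, t} \<le> card C" using sub by (intro card_mono)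
  then have "C \<in> nontrivial_demand_components V \<P>"
    using st sub(2) by (auto simp: nontrivial_demand_components_def Defs.components_def C_def quotient_def)
  then show ?thesis using R sub by simp
qed

section \<open>Equality of the optimum values\<close>

theorem theorem3:
  fixes V :: "'a set" and E :: "'a set set" and c :: "'a set \<Rightarrow> real"
    and \<P> :: "'a set set" and R :: "'a set" and r :: 'a
  assumes "steiner_forest_instance V E c \<P>"
    and "nontrivial_demand_components V \<P> = {R}"
    and "r \<in> R"
  shows "forest_bcr_opt V E c \<P> = tree_bcr_opt V E c R r"
proof (rule antisym)
  have V: "finite V" and E: "E \<subseteq> {{u, v} |u v. u \<in> V \<and> v \<in> V}"
    and P: "\<P> \<subseteq> {{s, t} |s t. s \<in> V \<and> t \<in> V}"
    using assms(1) by (auto simp: steiner_forest_instance_def ugraph_def)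
  have arcs: "arcs F \<subseteq> V \<times> V" if "F \<subseteq> {{u, v} |u v. u \<in> V \<and> v \<in> V}" for F
    using that by (force simp: arcs_def doubleton_eq_iff)
  have finP: "finite \<P>" using V P by (intro finite_subset[of \<P> "Pow V"]) auto
  have comp: "R \<in> Defs.components V \<P>"
    using assms(2) by (auto simp: nontrivial_demand_components_def)
  then have RV: "R \<subseteq> V" by (auto simp: Defs.components_def quotient_def)
  have cases: "Q \<subseteq> R \<or> (\<exists>s\<in>V. Q = {s})" if "Q \<in> \<P>" for Q
  proof -
    obtain s t where "Q = {s, t}" "s \<in> V" using P \<open>Q \<in> \<P>\<close> by blast
    then show ?thesis
      using pair_in_nontrivial_component[OF V arcs[OF P] assms(2), of s t] \<open>Q \<in> \<P>\<close>
      by (cases "s = t") auto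
  qed
  show "forest_bcr_opt V E c \<P> \<le> tree_bcr_opt V E c R r"
    unfolding tree_bcr_opt_def
  proof (rule INF_greatest)
    fix x assume "x \<in> {x. tree_bcr_feasible V E R r x}"
    then obtain x' z where "forest_bcr_feasible V E \<P> x' z"
      "(\<Sum>r\<in>V. \<Sum>a\<in>arcs E. arc_cost c a * x' r a) = (\<Sum>a\<in>arcs E. arc_cost c a * x a)"
      using forest_solution_of_tree_solution[OF V _ cases] RV assms(3) by blast
    then show "forest_bcr_opt V E c \<P> \<le> ereal (\<Sum>a\<in>arcs E. arc_cost c a * x a)"
      unfolding forest_bcr_opt_def by (intro INF_lower2[of "(x', z)"]) auto
  qed
  show "tree_bcr_opt V E c R r \<le> forest_bcr_opt V E c \<P>"
    unfolding forest_bcr_opt_def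
  proof (rule INF_greatest, clarsimp)
    fix x z assume feas: "forest_bcr_feasible V E \<P> x z"
    have grow: "\<exists>s\<in>R - S. \<exists>t\<in>S. {s, t} \<in> \<P>" if "r \<in> S" "S \<subset> R" for S
      using component_expands[OF comp assms(3) that arcs[OF P]] .
    obtain x' where "tree_bcr_feasible V E R r x'"
      "(\<Sum>a\<in>arcs E. arc_cost c a * x' a) = (\<Sum>r\<in>V. \<Sum>a\<in>arcs E. arc_cost c a * x r a)"
      by (rule tree_solution_of_forest_solution[OF V arcs[OF E] RV assms(3) finP grow feas])
    then show "tree_bcr_opt V E c R r \<le> ereal (\<Sum>r\<in>V. \<Sum>a\<in>arcs E. arc_cost c a * x r a)"
      unfolding tree_bcr_opt_def by (intro INF_lower2[of x']) auto
  qed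
qed

end
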